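(* Let $A$ be a real Hurwitz $d\times d$ matrix and let $T>0$. Then $T>T_{cut}(A)$ if and only if the minimum value in the extremal problem $$\|\boldsymbol{p}\|_{[0,T]}\to\min,\qquad \boldsymbol{p}(T)=1,\qquad \boldsymbol{p}\in\mathcal{P}_A,$$ is bigger than $1$, where $\|\boldsymbol{p}\|_{[0,T]}=\max_{t\in[0,T]}|\boldsymbol{p}(t)|$.
   Context: A matrix is Hurwitz if all its eigenvalues have negative real parts. For $\boldsymbol{x}_0\in\mathbb{R}^d$ let $\boldsymbol{x}(t)=e^{tA}\boldsymbol{x}_0$, $\Gamma=\{\boldsymbol{x}(t): t\ge 0\}$ and $G=\mathrm{co}\,(\Gamma\cup(-\Gamma))$ (convex hull). A number $T>0$ is a cut tail point of the trajectory if for every $t\ge T$ the point $\boldsymbol{x}(t)$ belongs to the relative interior of $G$ (the interior in its affine span). $T_{cut}(\boldsymbol{x}_0)$ is the infimum of all cut tail points of the trajectory starting at $\boldsymbol{x}_0$. Let $L_{\boldsymbol{x}_0}$ be the smallest $A$-invariant subspace containing $\boldsymbol{x}_0$, and let $n$ be the degree of the minimal polynomial of $A$; the point $\boldsymbol{x}_0$ is generic if $\dim L_{\boldsymbol{x}_0}=n$. The value $T_{cut}(\boldsymbol{x}_0)$ is the same for all generic $\boldsymbol{x}_0$ and is denoted $T_{cut}(A)$. $\mathcal{P}_A$ is the linear space of functions $t\mapsto (e^{tA}\boldsymbol{x}_0,\boldsymbol{y})$, $\boldsymbol{y}\in\mathbb{R}^d$, where $\boldsymbol{x}_0$ is a generic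 point and $(\cdot,\cdot)$ is the standard inner product; this space does not depend on the choice of the generic point $\boldsymbol{x}_0$, and $\dim\mathcal{P}_A=n$. *)

theory Defs
  imports "HOL-Analysis.Analysis" "HOL-Computational_Algebra.Polynomial"
begin

text \<open>
  The library's product, power and unit on the type of square matrices are componentwise and
  the type is not an instance of a normed algebra, so powers, polynomials and the exponential
  of a matrix are built here from the matrix product.
\<close>

primrec mat_pow :: "real ^ 'n ^ 'n \<Rightarrow> nat \<Rightarrow> real ^ 'n ^ 'n" where
  "mat_pow A 0 = mat 1"
| "mat_pow A (Suc k) = A ** mat_pow A k"

definition mat_exp :: "real ^ 'n ^ 'n \<Rightarrow> real ^ 'n ^ 'n" where
  "mat_exp A = (\<Sum>k. (1 / fact k) *\<^sub>R mat_pow A k)"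

definition poly_mat :: "real poly \<Rightarrow> real ^ 'n ^ 'n \<Rightarrow> real ^ 'n ^ 'n" where
  "poly_mat p A = (\<Sum>i\<le>degree p. coeff p i *\<^sub>R mat_pow A i)"

text \<open>The minimal polynomial: the (unique) monic annihilating polynomial of least degree.\<close>

definition min_poly :: "real ^ 'n ^ 'n \<Rightarrow> real poly" where
  "min_poly A = arg_min degree (\<lambda>p. lead_coeff p = 1 \<and> poly_mat p A = 0)"

definition eigenvalue :: "complex ^ 'n ^ 'n \<Rightarrow> complex \<Rightarrow> bool" where
  "eigenvalue B l \<longleftrightarrow> (\<exists>v. v \<noteq> 0 \<and> B *v v = l *s v)"

definition hurwitz :: "real ^ 'n ^ 'n \<Rightarrow> bool" where
  "hurwitz A \<longleftrightarrow> (\<forall>l. eigenvalue (map_matrix complex_of_real A) l \<longrightarrow> Re l < 0)"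

definition trajectory :: "real ^ 'n ^ 'n \<Rightarrow> real ^ 'n \<Rightarrow> real \<Rightarrow> real ^ 'n" where
  "trajectory A x0 t = mat_exp (t *\<^sub>R A) *v x0"

definition sym_hull :: "real ^ 'n ^ 'n \<Rightarrow> real ^ 'n \<Rightarrow> (real ^ 'n) set" where
  "sym_hull A x0 =
     convex hull (trajectory A x0 ` {0..} \<union> (\<lambda>t. - trajectory A x0 t) ` {0..})"

definition cut_tail_point :: "real ^ 'n ^ 'n \<Rightarrow> real ^ 'n \<Rightarrow> real \<Rightarrow> bool" where
  "cut_tail_point A x0 T \<longleftrightarrow>
     T > 0 \<and> (\<forall>t\<ge>T. trajectory A x0 t \<in> rel_interior (sym_hull A x0))"

text \<open>
  For a Hurwitz matrix the set of cut tail points is nonempty, since the trajectory tends to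
  0, which lies in the relative interior of the symmetric hull; so the real infimum is genuine.
\<close>

definition T_cut_at :: "real ^ 'n ^ 'n \<Rightarrow> real ^ 'n \<Rightarrow> real" where
  "T_cut_at A x0 = Inf {T. cut_tail_point A x0 T}"

definition invariant_subspace :: "real ^ 'n ^ 'n \<Rightarrow> (real ^ 'n) set \<Rightarrow> bool" where
  "invariant_subspace A S \<longleftrightarrow> subspace S \<and> (\<forall>v\<in>S. A *v v \<in> S)"

definition generic :: "real ^ 'n ^ 'n \<Rightarrow> real ^ 'n \<Rightarrow> bool" where
  "generic A x0 \<longleftrightarrow> dim (invariant_subspace A hull {x0}) = degree (min_poly A)"

text \<open>
  Generic points exist for every matrix, and the two objects below do not depend on the generic
  point, so both definite descriptions denote that common object.
\<close>

definition T_cut :: "real ^ 'n ^ 'n \<Rightarrow> real" where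
  "T_cut A = (THE c. \<forall>x0. generic A x0 \<longrightarrow> T_cut_at A x0 = c)"

definition trajectory_space :: "real ^ 'n ^ 'n \<Rightarrow> (real \<Rightarrow> real) set" where
  "trajectory_space A =
     (THE P. \<forall>x0. generic A x0 \<longrightarrow> range (\<lambda>y t. trajectory A x0 t \<bullet> y) = P)"

text \<open>The supremum is a maximum for continuous functions, hence on the trajectory space.\<close>

definition unif_norm :: "real \<Rightarrow> (real \<Rightarrow> real) \<Rightarrow> real" where
  "unif_norm T p = (SUP t\<in>{0..T}. \<bar>p t\<bar>)"

definition feasible :: "real ^ 'n ^ 'n \<Rightarrow> real \<Rightarrow> (real \<Rightarrow> real) \<Rightarrow> bool" where
  "feasible A T p \<longleftrightarrow> p \<in> trajectory_space A \<and> p T = 1"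

definition extremal_min :: "real ^ 'n ^ 'n \<Rightarrow> real \<Rightarrow> real" where
  "extremal_min A T = (LEAST m. \<exists>p. feasible A T p \<and> unif_norm T p = m)"

end

theory Submission
  imports Defs
    "HOL-Computational_Algebra.Polynomial_Factorial"
    "HOL-Computational_Algebra.Fundamental_Theorem_Algebra"
    "HOL-Computational_Algebra.Field_as_Ring"
    "HOL-Real_Asymp.Real_Asymp"
begin

text \<open>
  A point \<open>z\<close> of a symmetric convex hull is a relative interior point iff no linear functional that
  is nonzero on the hull attains its maximum over the hull at \<open>z\<close>. For \<open>z = x(s)\<close> this condition
  only involves the functions \<open>p\<close> in \<open>P\<^sub>A\<close>: there is no \<open>p\<close>, nonzero on \<open>[0, \<infinity>)\<close>, with \<open>\<bar>p\<bar> \<le> p(s)\<close> there.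
  Because \<open>P\<^sub>A\<close> is invariant under time shifts, a trajectory cannot leave the relative interior once
  it is inside, and since that set is relatively open, \<open>T > T_cut\<close> means that \<open>x(T)\<close> is inside.

  If \<open>x(T)\<close> is not inside, a normalised supporting functional gives \<open>p(T) = 1\<close> and \<open>\<bar>p\<bar> \<le> 1\<close>. Conversely,
  let \<open>p(T) = 1\<close> and \<open>\<bar>p\<bar> \<le> 1\<close> on \<open>[0, T]\<close>. As \<open>p\<close> tends to \<open>0\<close>, \<open>\<bar>p\<bar>\<close> attains its maximum over \<open>[0, \<infinity>)\<close>
  at some \<open>s \<ge> T\<close>, so \<open>x(s)\<close> is not inside and neither is \<open>x(T)\<close>.
\<close>

section \<open>Polynomials in a matrix and the minimal polynomial\<close>

text \<open>\<open>p(B) v\<close> is formed on vectors and over any field, because the decay argument needs complex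
  polynomials of a complexified matrix while \<open>poly_mat\<close> is real.\<close>

definition poly_act :: "'a::field ^ 'n ^ 'n \<Rightarrow> 'a poly \<Rightarrow> 'a ^ 'n \<Rightarrow> 'a ^ 'n" where
  "poly_act B p v = (\<Sum>i\<le>degree p. coeff p i *s (((*v) B) ^^ i) v)"

text \<open>A common upper summation limit allows polynomials of different degrees to be compared
  term by term.\<close>

lemma poly_act_upper:
  assumes "degree p \<le> m"
  shows "poly_act B p v = (\<Sum>i\<le>m. coeff p i *s (((*v) B) ^^ i) v)"
proof -
  have "(\<Sum>i\<le>m. coeff p i *s (((*v) B) ^^ i) v) = (\<Sum>i\<le>degree p. coeff p i *s (((*v) B) ^^ i) v)"
    using assms by (intro sum.mono_neutral_right) (auto simp: coeff_eq_0)
  then show ?thesis by (simp add: poly_act_def)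
qed

lemma poly_act_0 [simp]: "poly_act B 0 v = 0"
  by (simp add: poly_act_def)

lemma poly_act_1 [simp]: "poly_act B 1 v = v"
  by (simp add: poly_act_def)

lemma poly_act_add: "poly_act B (p + q) v = poly_act B p v + poly_act B q v"
proof -
  let ?m = "max (degree p) (degree q)"
  show ?thesis
    using poly_act_upper[of "p + q" ?m B v] poly_act_upper[of p ?m B v] poly_act_upper[of q ?m B v]
    by (simp add: degree_add_le vec.scale_left_distrib sum.distrib)
qed

lemma poly_act_smult: "poly_act B (smult c p) v = c *s poly_act B p v"
  using poly_act_upper[of "smult c p" "degree p" B v]
  by (simp add: poly_act_def vec.scale_sum_right)

lemma poly_act_sum: "poly_act B (\<Sum>i\<in>I. f i) v = (\<Sum>i\<in>I. poly_act B (f i) v)"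
  by (induction I rule: infinite_finite_induct) (simp_all add: poly_act_add)

lemma poly_act_monom: "poly_act B (monom c i) v = c *s (((*v) B) ^^ i) v"
proof -
  have "poly_act B (monom c i) v = (\<Sum>j\<le>i. coeff (monom c i) j *s (((*v) B) ^^ j) v)"
    by (rule poly_act_upper) (rule degree_monom_le)
  also have "\<dots> = (\<Sum>j\<in>{i}. c *s (((*v) B) ^^ j) v)"
    by (rule sum.mono_neutral_cong_right) auto
  finally show ?thesis by simp
qed

lemma poly_act_pCons: "poly_act B (pCons a p) v = a *s v + B *v poly_act B p v"
proof -
  have "poly_act B (pCons a p) v = (\<Sum>i\<le>Suc (degree p). coeff (pCons a p) i *s (((*v) B) ^^ i) v)"
    by (rule poly_act_upper) (simp add: degree_pCons_le)
  also have "\<dots> = a *s v + (\<Sum>i\<le>degree p. coeff p i *s (B *v (((*v) B) ^^ i) v))"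
    by (subst sum.atMost_Suc_shift) simp
  also have "\<dots> = a *s v + B *v poly_act B p v"
    by (simp add: poly_act_def vec.sum vec.scale)
  finally show ?thesis .
qed

lemma linear_poly_act: "Vector_Spaces.linear (*s) (*s) (poly_act B p)"
proof (induction p)
  case 0
  show ?case by (simp add: vec.linear_zero poly_act_def)
next
  case (pCons a p)
  have "Vector_Spaces.linear (*s) (*s) (\<lambda>v. a *s v + B *v poly_act B p v)"
    using Vector_Spaces.linear_compose[OF pCons(2) matrix_vector_mul_linear_gen[of B]]
    by (intro vec.linear_compose_add vec.linear_scale_self) (simp add: o_def)
  then show ?case by (simp add: poly_act_pCons)
qed

text \<open>This turns divisibility, Bezout identities and linear factors of polynomials into
  statements about kernels and eigenvectors.\<close>

lemma poly_act_mult: "poly_act B (p * q) v = poly_act B p (poly_act B q v)"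
proof (induction p)
  case (pCons a p)
  then show ?case
    by (simp add: poly_act_add poly_act_smult poly_act_pCons)
qed simp

lemma poly_act_eq_0_dvd:
  assumes "p dvd q" "poly_act B p v = 0"
  shows "poly_act B q v = 0"
proof -
  from \<open>p dvd q\<close> obtain r where "q = r * p"
    by (metis dvdE mult.commute)
  with assms(2) show ?thesis
    by (simp add: poly_act_mult vec.linear_0[OF linear_poly_act])
qed

section \<open>Matrix powers, linear relations and annihilating polynomials\<close>

lemma funpow_mult_vec_eq_mat_pow: "(((*v) A) ^^ k) x = mat_pow A k *v x"
  by (induction k) (simp_all add: matrix_vector_mul_assoc)

lemma matrix_vector_mult_sum_left:
  fixes f :: "'i \<Rightarrow> real ^ 'n ^ 'm"
  shows "(\<Sum>i\<in>I. f i) *v x = (\<Sum>i\<in>I. f i *v x)"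
  by (induction I rule: infinite_finite_induct) (simp_all add: matrix_vector_mult_add_rdistrib)

lemma poly_mat_mult_vec: "poly_mat p A *v x = poly_act A p x"
  by (simp add: poly_mat_def poly_act_def matrix_vector_mult_sum_left funpow_mult_vec_eq_mat_pow
      scaleR_matrix_vector_assoc[symmetric] scalar_mult_eq_scaleR)

lemma poly_mat_eq_0_iff: "poly_mat p A = 0 \<longleftrightarrow> (\<forall>x. poly_act A p x = 0)"
  by (metis matrix_eq matrix_vector_mult_0 poly_mat_mult_vec)

text \<open>The relation is indexed by \<open>I\<close>, whereas \<open>independent\<close> concerns
  sets and does not see repetitions. Failure of injectivity is therefore a second source of a
  relation, namely \<open>u i - u j = 0\<close>.\<close>

lemma indexed_linear_relation:
  fixes u :: "nat \<Rightarrow> 'a::real_vector"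
  assumes "finite I" and "\<not> (inj_on u I \<and> independent (u ` I))"
  obtains c where "\<exists>i\<in>I. c i \<noteq> 0" "(\<Sum>i\<in>I. c i *\<^sub>R u i) = 0"
proof (cases "inj_on u I")
  case True
  then have "dependent (u ` I)" using assms(2) by simp
  then obtain f v where fv: "v \<in> u ` I" "f v \<noteq> 0" "(\<Sum>v\<in>u ` I. f v *\<^sub>R v) = 0"
    using assms(1) by (subst (asm) dependent_finite) auto
  show ?thesis
  proof (rule that[of "f \<circ> u"])
    show "\<exists>i\<in>I. (f \<circ> u) i \<noteq> 0" using fv by auto
    show "(\<Sum>i\<in>I. (f \<circ> u) i *\<^sub>R u i) = 0"
      using fv(3) True by (simp add: sum.reindex)
  qed
next
  case False
  then obtain i j where ij: "i \<in> I" "j \<in> I" "i \<noteq> j" "u i = u j"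
    by (auto simp: inj_on_def)
  define c :: "nat \<Rightarrow> real" where "c = (\<lambda>k. (if k = i then 1 else 0) - (if k = j then 1 else 0))"
  show ?thesis
  proof (rule that[of c])
    show "\<exists>k\<in>I. c k \<noteq> 0" using ij by (auto simp: c_def)
    have "(\<Sum>k\<in>I. c k *\<^sub>R u k) = (\<Sum>k\<in>I. if k = i then u k else 0) - (\<Sum>k\<in>I. if k = j then u k else 0)"
      by (subst sum_subtractf[symmetric]) (rule sum.cong, auto simp: c_def)
    then show "(\<Sum>k\<in>I. c k *\<^sub>R u k) = 0" using ij assms(1) by simp
  qed
qed

lemma exists_linear_relation:
  fixes u :: "nat \<Rightarrow> 'a::euclidean_space"
  obtains c where "\<exists>i\<le>DIM('a). c i \<noteq> 0" "(\<Sum>i\<le>DIM('a). c i *\<^sub>R u i) = 0"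
proof -
  have "\<not> (inj_on u {..DIM('a)} \<and> independent (u ` {..DIM('a)}))"
  proof
    assume a: "inj_on u {..DIM('a)} \<and> independent (u ` {..DIM('a)})"
    then have "card (u ` {..DIM('a)}) = Suc DIM('a)" by (simp add: card_image)
    then show False using a independent_card_le[of "u ` {..DIM('a)}"] by simp
  qed
  then show ?thesis
    using indexed_linear_relation[of "{..DIM('a)}" u] that by auto
qed

lemma coeff_sum_monom:
  assumes "finite I"
  shows "coeff (\<Sum>i\<in>I. monom (c i) i) j = (if j \<in> I then c j else 0)"
  using assms by (simp add: coeff_sum)

text \<open>One more power than the dimension of the matrix space forces a linear relation, whose
  coefficients form a nonzero polynomial. Dividing by the leading coefficient makes it
  monic.\<close>

lemma exists_annihilating_poly:
  fixes A :: "real ^ 'n ^ 'n"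
  shows "\<exists>p. lead_coeff p = 1 \<and> poly_mat p A = 0"
proof -
  let ?N = "DIM(real ^ 'n ^ 'n)"
  obtain c where c: "\<exists>i\<le>?N. c i \<noteq> 0" "(\<Sum>i\<le>?N. c i *\<^sub>R mat_pow A i) = 0"
    by (rule exists_linear_relation)
  define p where "p = (\<Sum>i\<le>?N. monom (c i) i)"
  have "p \<noteq> 0"
    using c(1) coeff_sum_monom[of "{..?N}" c] unfolding p_def by (metis atMost_iff coeff_0 finite_atMost)
  have "poly_act A p x = 0" for x
  proof -
    have "poly_act A p x = (\<Sum>i\<le>?N. c i *\<^sub>R mat_pow A i) *v x"
      by (simp add: p_def poly_act_sum poly_act_monom funpow_mult_vec_eq_mat_pow
          matrix_vector_mult_sum_left scaleR_matrix_vector_assoc[symmetric] scalar_mult_eq_scaleR)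
    then show ?thesis using c(2) by simp
  qed
  then have "poly_mat (smult (inverse (lead_coeff p)) p) A = 0"
    by (simp add: poly_mat_eq_0_iff poly_act_smult)
  moreover have "lead_coeff (smult (inverse (lead_coeff p)) p) = 1"
    using \<open>p \<noteq> 0\<close> by simp
  ultimately show ?thesis by blast
qed

section \<open>The minimal polynomial and a vector that no smaller polynomial annihilates\<close>

lemma min_poly_properties:
  shows lead_coeff_min_poly: "lead_coeff (min_poly A) = 1"
    and poly_mat_min_poly: "poly_mat (min_poly A) A = 0"
  using arg_min_natI[of "\<lambda>p. lead_coeff p = 1 \<and> poly_mat p A = 0" _ degree] exists_annihilating_poly[of A]
  by (auto simp: min_poly_def)

lemma min_poly_nonzero: "min_poly A \<noteq> 0"
  using lead_coeff_min_poly[of A] by auto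

lemma degree_min_poly_le:
  assumes "p \<noteq> 0" "poly_mat p A = 0"
  shows "degree (min_poly A) \<le> degree p"
proof -
  have "poly_mat (smult (inverse (lead_coeff p)) p) A = 0"
    using assms(2) by (simp add: poly_mat_eq_0_iff poly_act_smult)
  moreover have "lead_coeff (smult (inverse (lead_coeff p)) p) = 1"
    using \<open>p \<noteq> 0\<close> by simp
  ultimately have "degree (min_poly A) \<le> degree (smult (inverse (lead_coeff p)) p)"
    unfolding min_poly_def by (intro arg_min_nat_le) simp
  then show ?thesis using \<open>p \<noteq> 0\<close> by simp
qed

lemma poly_act_mod_min_poly: "poly_act A (p mod min_poly A) x = poly_act A p x"
proof -
  have "poly_act A (p div min_poly A * min_poly A) x = 0"
    by (rule poly_act_eq_0_dvd[of "min_poly A"]) (use poly_mat_min_poly[of A] in \<open>auto simp: poly_mat_eq_0_iff\<close>)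
  then show ?thesis
    by (metis add_0 div_mult_mod_eq poly_act_add)
qed

text \<open>A monic constant is 1 and acts as the identity, which does not kill a unit
  vector.\<close>

lemma degree_min_poly_pos: "degree (min_poly A) > 0"
proof (rule ccontr)
  assume "\<not> ?thesis"
  then have "min_poly A = 1"
    using lead_coeff_min_poly[of A] by (metis degree_eq_zeroE gr0I lead_coeff_pCons(2) one_pCons)
  then have "(axis undefined 1 :: real ^ 'a) = 0"
    using poly_mat_min_poly[of A] by (metis poly_act_1 poly_mat_eq_0_iff)
  then show False by (simp add: axis_eq_0_iff)
qed

text \<open>Normalisation picks one divisor from each class of associates. By induction on prime
  factors, a divisor of \<open>p * x\<close> divides \<open>x\<close> or is \<open>p\<close> times a
  divisor of \<open>x\<close>.\<close>

lemma finite_normalized_divisors: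
  fixes x :: "'a::{factorial_semiring,normalization_semidom_multiplicative}"
  assumes "x \<noteq> 0"
  shows "finite {y. y dvd x \<and> normalize y = y}"
  using assms
proof (induction x rule: prime_divisors_induct)
  case (unit x)
  have "y = 1" if "y dvd x" "normalize y = y" for y
    using that unit by (metis dvd_trans is_unit_normalize)
  then have "{y. y dvd x \<and> normalize y = y} \<subseteq> {1}" by auto
  then show ?case by (rule finite_subset) simp
next
  case (factor p x)
  let ?D = "{y. y dvd x \<and> normalize y = y}"
  have "x \<noteq> 0" using factor by auto
  have sub: "y \<in> ?D \<union> (\<lambda>z. p * z) ` ?D" if y: "y dvd p * x" "normalize y = y" for y
  proof (cases "p dvd y")
    case True
    then obtain z where z: "y = p * z" by blast
    have "p \<noteq> 0" using factor by auto
    then have "z dvd x" using y z by auto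
    moreover have "normalize z = z"
      using y(2) z \<open>p \<noteq> 0\<close> factor by (auto simp: normalize_mult)
    ultimately show ?thesis using z by blast
  next
    case False
    obtain c where c: "p * x = y * c" using y(1) by blast
    then have "p dvd y * c" by (metis dvd_triv_left)
    with False obtain c' where "c = p * c'"
      using factor by (auto simp: prime_dvd_mult_iff)
    with c have "p * x = p * (y * c')" by (simp add: ac_simps)
    with factor have "x = y * c'" by (metis mult_left_cancel not_prime_0)
    then show ?thesis using y by auto
  qed
  have "finite ?D" using factor \<open>x \<noteq> 0\<close> by simp
  then have "finite (?D \<union> (\<lambda>z. p * z) ` ?D)" by simp
  moreover have "{y. y dvd p * x \<and> normalize y = y} \<subseteq> ?D \<union> (\<lambda>z. p * z) ` ?D"
    by (rule subsetI, rule sub) simp_all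
  ultimately show ?case by (rule rev_finite_subset)
qed simp

text \<open>If a nonzero \<open>q\<close> of smaller degree annihilates \<open>x\<close>, so does \<open>gcd q (min_poly A)\<close>; hence the bad
  points lie in the kernels of finitely many proper divisors, which are proper subspaces.\<close>

lemma exists_min_poly_point:
  "\<exists>x. \<forall>q. q \<noteq> 0 \<longrightarrow> degree q < degree (min_poly A) \<longrightarrow> poly_act A q x \<noteq> 0"
proof -
  let ?n = "degree (min_poly A)"
  define D where "D = {g. g dvd min_poly A \<and> normalize g = g \<and> degree g < ?n}"
  have "finite D"
    using finite_normalized_divisors[OF min_poly_nonzero[of A]]
    by (rule finite_subset[rotated]) (auto simp: D_def)
  \<comment> \<open>By minimality of the degree, \<open>g\<close> does not annihilate all vectors.
    Its kernel is a proper subspace, hence a null set, and finitely many null sets cannot cover the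
    space.\<close>
  have "negligible {x. poly_act A g x = 0}" if "g \<in> D" for g
  proof -
    have "g \<noteq> 0" using that min_poly_nonzero[of A] by (auto simp: D_def)
    have "{x. poly_act A g x = 0} \<noteq> UNIV"
      using degree_min_poly_le[OF \<open>g \<noteq> 0\<close>, of A] that by (auto simp: D_def poly_mat_eq_0_iff)
    moreover have "{x. poly_act A g x = 0} = {x. poly_mat g A *v x = 0}"
      by (simp add: poly_mat_mult_vec)
    then have "subspace {x. poly_act A g x = 0}"
      using linear_subspace_kernel[of "(*v) (poly_mat g A)"] by simp
    ultimately have "dim {x. poly_act A g x = 0} \<noteq> DIM(real ^ 'a)"
      unfolding dim_eq_full by (simp only: span_eq_iff[THEN iffD2] not_False_eq_True)
    then show ?thesis
      using dim_subset_UNIV[of "{x. poly_act A g x = 0}"] by (intro negligible_lowdim) simp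
  qed
  with \<open>finite D\<close> have "negligible (\<Union>g\<in>D. {x. poly_act A g x = 0})"
    by (intro negligible_Union) auto
  then have "(\<Union>g\<in>D. {x. poly_act A g x = 0}) \<noteq> UNIV"
    by (metis non_negligible_UNIV)
  then obtain x where x: "\<And>g. g \<in> D \<Longrightarrow> poly_act A g x \<noteq> 0" by blast
  have "poly_act A q x \<noteq> 0" if q: "q \<noteq> 0" "degree q < ?n" for q
  proof
    assume 0: "poly_act A q x = 0"
    \<comment> \<open>By Bezout, \<open>g\<close> kills \<open>x\<close> as well. It divides
      \<open>q\<close>, so its degree is below that of \<open>min_poly A\<close> and it belongs to
      \<open>D\<close>.\<close>
    define g where "g = gcd q (min_poly A)"
    obtain a b where "a * q + b * min_poly A = g"
      unfolding g_def using bezout_coefficients_fst_snd by blast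
    then have "poly_act A g x = 0"
      using 0 poly_mat_min_poly[of A]
      by (auto simp: poly_act_add poly_act_mult poly_mat_eq_0_iff vec.linear_0[OF linear_poly_act] simp flip: \<open>_ = g\<close>)
    moreover have "g \<in> D"
      using q dvd_imp_degree_le[of g q] by (auto simp: D_def g_def)
    ultimately show False using x by blast
  qed
  then show ?thesis by blast
qed

section \<open>The matrix exponential and trajectories\<close>

lemma bounded_bilinear_matrix_matrix_mult:
  "bounded_bilinear ((**) :: real ^ 'n ^ 'm \<Rightarrow> real ^ 'p ^ 'n \<Rightarrow> real ^ 'p ^ 'm)"
  unfolding bilinear_conv_bounded_bilinear[symmetric] bilinear_def
  by (auto intro!: linearI simp: vec_eq_iff matrix_matrix_mult_def sum.distrib algebra_simps sum_distrib_left)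

lemma bounded_bilinear_matrix_vector_mult:
  "bounded_bilinear ((*v) :: real ^ 'n ^ 'm \<Rightarrow> real ^ 'n \<Rightarrow> real ^ 'm)"
  unfolding bilinear_conv_bounded_bilinear[symmetric] bilinear_def
  by (auto intro!: linearI simp: vec_eq_iff matrix_vector_mult_def sum.distrib algebra_simps sum_distrib_left)

lemma has_vector_derivative_componentwise:
  fixes f :: "real \<Rightarrow> 'a::euclidean_space"
  assumes "\<And>b. b \<in> Basis \<Longrightarrow> ((\<lambda>x. f x \<bullet> b) has_real_derivative f' \<bullet> b) (at x)"
  shows "(f has_vector_derivative f') (at x)"
  unfolding has_vector_derivative_def
  by (subst has_derivative_componentwise_within)
    (use assms in \<open>auto simp: has_field_derivative_def mult_commute_abs\<close>)

text \<open>Geometric growth of \<open>u\<close> is dominated by the factorials. Applied to matrix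
  powers, this gives convergence of the exponential series and its derivative.\<close>

lemma
  fixes u :: "nat \<Rightarrow> 'a::euclidean_space"
  assumes u: "\<And>k. norm (u k) \<le> C * r ^ k"
  shows summable_exp_bounded: "summable (\<lambda>k. (t ^ k / fact k) *\<^sub>R u k)"
    and exp_series_has_vector_derivative:
      "((\<lambda>t. \<Sum>k. (t ^ k / fact k) *\<^sub>R u k) has_vector_derivative
        (\<Sum>k. (t ^ k / fact k) *\<^sub>R u (Suc k))) (at t)"
proof -
  have sm: "summable (\<lambda>k. (t ^ k / fact k) *\<^sub>R v k)" if v: "\<And>k. norm (v k) \<le> C * r ^ k"
    for v :: "nat \<Rightarrow> 'a" and C t
  proof (rule summable_comparison_test')
    show "summable (\<lambda>k. C * (inverse (fact k) * (\<bar>t\<bar> * r) ^ k))"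
      by (intro summable_mult summable_exp)
    fix k :: nat assume "k \<ge> 0"
    have "norm ((t ^ k / fact k) *\<^sub>R v k) = (\<bar>t\<bar> ^ k / fact k) * norm (v k)"
      by (simp add: power_abs)
    also have "\<dots> \<le> (\<bar>t\<bar> ^ k / fact k) * (C * r ^ k)"
      by (intro mult_left_mono v) auto
    finally show "norm ((t ^ k / fact k) *\<^sub>R v k) \<le> C * (inverse (fact k) * (\<bar>t\<bar> * r) ^ k)"
      by (simp add: field_simps power_mult_distrib)
  qed
  show sm0: "summable (\<lambda>k. (t ^ k / fact k) *\<^sub>R u k)" for t by (rule sm[OF u])
  have sm1: "summable (\<lambda>k. (t ^ k / fact k) *\<^sub>R u (Suc k))"
    by (rule sm[of _ "C * r"]) (use u[of "Suc _"] in \<open>simp add: mult.assoc\<close>)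
  show "((\<lambda>t. \<Sum>k. (t ^ k / fact k) *\<^sub>R u k) has_vector_derivative
        (\<Sum>k. (t ^ k / fact k) *\<^sub>R u (Suc k))) (at t)"
  proof (rule has_vector_derivative_componentwise)
    fix b :: 'a assume "b \<in> Basis"
    \<comment> \<open>Each coordinate is an everywhere convergent real power series with
      coefficients \<open>c\<close>. In \<open>diffs c\<close> the factor \<open>k + 1\<close>
      cancels against the factorial, leaving the shifted sequence.\<close>
    define c where "c k = (u k \<bullet> b) / fact k" for k
    have eq: "(\<Sum>k. (t ^ k / fact k) *\<^sub>R u k) \<bullet> b = (\<Sum>k. c k * t ^ k)" for t
      using bounded_linear.suminf[OF bounded_linear_inner_left[of b] sm0[of t]]
      by (simp add: c_def mult.commute)
    have eq1: "(\<Sum>k. (t ^ k / fact k) *\<^sub>R u (Suc k)) \<bullet> b = (\<Sum>k. diffs c k * t ^ k)"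
      using bounded_linear.suminf[OF bounded_linear_inner_left[of b] sm1]
      by (simp add: c_def diffs_def mult.commute)
    have "summable (\<lambda>k. c k * s ^ k)" for s
      using bounded_linear.summable[OF bounded_linear_inner_left[of b] sm0[of s]]
      by (simp add: c_def mult.commute)
    then have "((\<lambda>x. \<Sum>n. c n * x ^ n) has_field_derivative (\<Sum>n. diffs c n * t ^ n)) (at t)"
      by (rule termdiffs_strong_converges_everywhere)
    then show "((\<lambda>t. (\<Sum>k. (t ^ k / fact k) *\<^sub>R u k) \<bullet> b) has_real_derivative
        (\<Sum>k. (t ^ k / fact k) *\<^sub>R u (Suc k)) \<bullet> b) (at t)"
      by (simp only: eq eq1)
  qed
qed

text \<open>Matrix multiplication enters only as a bounded bilinear map, so its constant
  \<open>K\<close> is absorbed into the ratio \<open>r\<close>.\<close>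

lemma mat_pow_bound:
  fixes A :: "real ^ 'n ^ 'n"
  obtains C r where "\<And>k. norm (mat_pow A k) \<le> C * r ^ k"
proof -
  have "bounded_bilinear ((**) :: real ^ 'n ^ 'n \<Rightarrow> real ^ 'n ^ 'n \<Rightarrow> real ^ 'n ^ 'n)"
    by (rule bounded_bilinear_matrix_matrix_mult)
  from bounded_bilinear.pos_bounded[OF this]
  obtain K where K: "\<And>X Y. norm ((X :: real ^ 'n ^ 'n) ** (Y :: real ^ 'n ^ 'n)) \<le> norm X * norm Y * K" "K > 0"
    by blast
  have "norm (mat_pow A k) \<le> norm (mat 1 :: real ^ 'n ^ 'n) * (norm A * K) ^ k" for k
  proof (induction k)
    case (Suc k)
    have "norm (mat_pow A (Suc k)) \<le> (norm A * K) * norm (mat_pow A k)"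
      using K(1)[of A "mat_pow A k"] by (simp add: mult_ac)
    also have "\<dots> \<le> (norm A * K) * (norm (mat 1 :: real ^ 'n ^ 'n) * (norm A * K) ^ k)"
      using K(2) by (intro mult_left_mono Suc) auto
    finally show ?case by (simp add: mult_ac)
  qed simp
  then show ?thesis using that by blast
qed

lemma mat_pow_scaleR: "mat_pow (t *\<^sub>R A) k = t ^ k *\<^sub>R mat_pow A k"
  by (induction k) (simp_all add: bounded_bilinear.scaleR_left[OF bounded_bilinear_matrix_matrix_mult]
      bounded_bilinear.scaleR_right[OF bounded_bilinear_matrix_matrix_mult])

lemma mat_exp_scaleR: "mat_exp (t *\<^sub>R A) = (\<Sum>k. (t ^ k / fact k) *\<^sub>R mat_pow A k)"
  by (simp add: mat_exp_def mat_pow_scaleR)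

lemma mat_exp_sums: "(\<lambda>k. (t ^ k / fact k) *\<^sub>R mat_pow A k) sums mat_exp (t *\<^sub>R A)"
proof -
  obtain C r where "\<And>k. norm (mat_pow A k) \<le> C * r ^ k" using mat_pow_bound[of A] by blast
  then show ?thesis
    unfolding mat_exp_scaleR by (intro summable_sums summable_exp_bounded)
qed

lemma mat_pow_commute: "mat_pow A k ** A = A ** mat_pow A k"
  by (induction k) (simp_all add: matrix_mul_assoc[symmetric])

lemma mat_exp_commute: "mat_exp (t *\<^sub>R A) ** A = A ** mat_exp (t *\<^sub>R A)"
  using bounded_linear.sums[OF bounded_bilinear.bounded_linear_left[OF bounded_bilinear_matrix_matrix_mult, of A] mat_exp_sums[of t A]]
    bounded_linear.sums[OF bounded_bilinear.bounded_linear_right[OF bounded_bilinear_matrix_matrix_mult, of A] mat_exp_sums[of t A]]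
  by (simp add: bounded_bilinear.scaleR_left[OF bounded_bilinear_matrix_matrix_mult]
      bounded_bilinear.scaleR_right[OF bounded_bilinear_matrix_matrix_mult] mat_pow_commute sums_unique2)

lemma mat_exp_has_vector_derivative:
  "((\<lambda>t. mat_exp (t *\<^sub>R A)) has_vector_derivative A ** mat_exp (t *\<^sub>R A)) (at t)"
proof -
  obtain C r where "\<And>k. norm (mat_pow A k) \<le> C * r ^ k" using mat_pow_bound[of A] by blast
  then have "((\<lambda>t. mat_exp (t *\<^sub>R A)) has_vector_derivative
      (\<Sum>k. (t ^ k / fact k) *\<^sub>R mat_pow A (Suc k))) (at t)"
    unfolding mat_exp_scaleR by (rule exp_series_has_vector_derivative)
  moreover have "(\<lambda>k. (t ^ k / fact k) *\<^sub>R mat_pow A (Suc k)) sums (A ** mat_exp (t *\<^sub>R A))"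
    using bounded_linear.sums[OF bounded_bilinear.bounded_linear_right[OF bounded_bilinear_matrix_matrix_mult, of A] mat_exp_sums[of t A]]
    by (simp add: bounded_bilinear.scaleR_right[OF bounded_bilinear_matrix_matrix_mult])
  ultimately show ?thesis by (simp add: sums_iff)
qed

lemma mat_exp_0: "mat_exp (0 *\<^sub>R A) = mat 1"
proof -
  have "(\<lambda>k. (0 ^ k / fact k) *\<^sub>R mat_pow A k) = (\<lambda>k. if k = 0 then mat 1 else 0)"
    by auto
  then have "(\<lambda>k. (0 ^ k / fact k) *\<^sub>R mat_pow A k) sums mat 1"
    using sums_single[of 0 "\<lambda>_. mat 1 :: real ^ 'a ^ 'a"] by simp
  then show ?thesis
    using mat_exp_sums[of 0 A] sums_unique2 by fastforce
qed

text \<open>The product of the exponentials at times \<open>s + t - h\<close> and \<open>h\<close>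
  has derivative 0 in \<open>h\<close>, because \<open>A\<close> commutes with its
  exponential.\<close>

lemma mat_exp_add: "mat_exp ((s + t) *\<^sub>R A) = mat_exp (s *\<^sub>R A) ** mat_exp (t *\<^sub>R A)"
proof -
  let ?E = "\<lambda>t. mat_exp (t *\<^sub>R A)"
  have "((\<lambda>h. ?E (s + t - h) ** ?E h) has_vector_derivative 0) (at h within UNIV)" for h
  proof -
    have "((\<lambda>h. ?E (s + t - h)) has_vector_derivative (- 1) *\<^sub>R (A ** ?E (s + t - h))) (at h)"
    proof -
      have "((\<lambda>h. s + t - h) has_vector_derivative - 1) (at h)"
        unfolding has_real_derivative_iff_has_vector_derivative[symmetric]
        by (auto intro!: derivative_eq_intros)
      from vector_diff_chain_at[OF this mat_exp_has_vector_derivative]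
      show ?thesis by (simp only: o_def)
    qed
    then have "((\<lambda>h. ?E (s + t - h) ** ?E h) has_vector_derivative
        (?E (s + t - h) ** (A ** ?E h) + ((- 1) *\<^sub>R (A ** ?E (s + t - h))) ** ?E h)) (at h)"
      by (rule bounded_bilinear.has_vector_derivative[OF bounded_bilinear_matrix_matrix_mult])
        (rule mat_exp_has_vector_derivative)
    moreover have "?E (s + t - h) ** (A ** ?E h) + ((- 1) *\<^sub>R (A ** ?E (s + t - h))) ** ?E h = 0"
      by (simp add: bounded_bilinear.minus_left[OF bounded_bilinear_matrix_matrix_mult]
          matrix_mul_assoc mat_exp_commute)
    ultimately show ?thesis by simp
  qed
  then obtain c where "\<And>h. ?E (s + t - h) ** ?E h = c"
    using has_vector_derivative_zero_constant[of UNIV "\<lambda>h. ?E (s + t - h) ** ?E h"] by auto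
  \<comment> \<open>At \<open>h = t\<close> the constant is the product of the two exponentials, at
    \<open>h = 0\<close> it is the exponential of the sum.\<close>
  from this[of t] this[of 0] show ?thesis by (simp add: mat_exp_0[simplified])
qed

section \<open>Trajectories as solutions of the linear differential equation\<close>

lemma trajectory_0 [simp]: "trajectory A x 0 = x"
  by (simp add: trajectory_def mat_exp_0[simplified])

lemma trajectory_add: "trajectory A x (s + t) = mat_exp (s *\<^sub>R A) *v trajectory A x t"
  by (simp add: trajectory_def mat_exp_add matrix_vector_mul_assoc del: scaleR_left.add)

lemma trajectory_nonzero:
  assumes "x \<noteq> 0"
  shows "trajectory A x t \<noteq> 0"
proof
  assume "trajectory A x t = 0"
  then have "trajectory A x (- t + t) = 0"
    by (simp only: trajectory_add matrix_vector_mult_0_right)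
  with assms show False by simp
qed

lemma trajectory_has_vector_derivative:
  "(trajectory A x has_vector_derivative trajectory A (A *v x) t) (at t)"
proof -
  have "((\<lambda>t. mat_exp (t *\<^sub>R A) *v x) has_vector_derivative (A ** mat_exp (t *\<^sub>R A)) *v x) (at t)"
    by (rule bounded_linear.has_vector_derivative[OF bounded_bilinear.bounded_linear_left[OF bounded_bilinear_matrix_vector_mult]])
      (rule mat_exp_has_vector_derivative)
  then show ?thesis
    by (simp add: trajectory_def[abs_def] matrix_vector_mul_assoc mat_exp_commute)
qed

lemma continuous_on_trajectory: "continuous_on S (trajectory A x)"
  using trajectory_has_vector_derivative
  by (metis continuous_at_imp_continuous_on has_vector_derivative_continuous)

lemma trajectory_sums: "(\<lambda>k. (t ^ k / fact k) *\<^sub>R (mat_pow A k *v x)) sums trajectory A x t"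
  using bounded_linear.sums[OF bounded_bilinear.bounded_linear_left[OF bounded_bilinear_matrix_vector_mult, of x] mat_exp_sums[of t A]]
  by (simp add: trajectory_def scaleR_matrix_vector_assoc[symmetric])

section \<open>Decay for Hurwitz matrices\<close>

text \<open>Variation of constants: the integrating factor removes the term \<open>l * f t\<close>,
  and what remains is bounded by integrating the estimate for \<open>g\<close>.\<close>

lemma exp_decay_of_linear_ode:
  fixes f :: "real \<Rightarrow> complex"
  assumes deriv: "\<And>t. (f has_vector_derivative l * f t + g t) (at t)"
    and l: "Re l < 0" and a: "a > 0" and g: "\<And>t. t \<ge> 0 \<Longrightarrow> norm (g t) \<le> C * exp (- a * t)"
  shows "\<exists>a>0. \<exists>C. \<forall>t\<ge>0. norm (f t) \<le> C * exp (- a * t)"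
proof -
  \<comment> \<open>Halving makes \<open>b\<close> strictly smaller than \<open>- Re l\<close>, so
    \<open>m > 0\<close> even in the resonant case \<open>a = - Re l\<close>, and division by
    \<open>m\<close> is harmless.\<close>
  define b where "b = min a (- Re l) / 2"
  define m where "m = - Re l - b"
  have b: "b > 0" "b \<le> a" "Re l \<le> - b" using l a by (auto simp: b_def)
  have m: "m > 0" using l a by (auto simp: m_def b_def min_def)
  have C: "C \<ge> 0" using g[of 0] norm_ge_zero[of "g 0"] by (simp del: norm_ge_zero)
  define h where "h t = exp (- (of_real t * l)) * f t" for t
  have h': "(h has_vector_derivative exp (- (of_real t * l)) * g t) (at t)" for t
  proof -
    have "((\<lambda>t. exp (- (of_real t * l))) has_vector_derivative (- l) * exp (- (of_real t * l))) (at t)"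
      using exp_scaleR_has_vector_derivative_right[of "- l" t]
      by (simp add: scaleR_conv_of_real mult.commute)
    from has_vector_derivative_mult[OF this deriv[of t]]
    show ?thesis by (simp add: h_def[abs_def] algebra_simps)
  qed
  have bound: "norm (h t) \<le> norm (f 0) + C / m * exp (m * t)" if "t \<ge> 0" for t
  proof (cases "t = 0")
    case True
    then show ?thesis using C m by (simp add: h_def)
  next
    case False
    with that have "t > 0" by simp
    \<comment> \<open>The comparison function is an antiderivative of the bound
      \<open>C * exp (m * x)\<close> on the norm of the derivative of \<open>h\<close>.\<close>
    have "norm (h t - h 0) \<le> C / m * exp (m * t) - C / m * exp (m * 0)"
    proof (rule differentiable_bound_general[OF \<open>t > 0\<close>])
      show "continuous_on {0..t} h"
        using h' by (meson continuous_at_imp_continuous_on has_vector_derivative_continuous)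
      show "continuous_on {0..t} (\<lambda>x. C / m * exp (m * x))"
        by (intro continuous_intros)
      show "(h has_vector_derivative exp (- (of_real x * l)) * g x) (at x)" for x by (rule h')
      show "((\<lambda>x. C / m * exp (m * x)) has_vector_derivative C * exp (m * x)) (at x)" for x
        unfolding has_real_derivative_iff_has_vector_derivative[symmetric]
        using m by (auto intro!: derivative_eq_intros)
      fix x assume "0 < x" "x < t"
      have "norm (exp (- (of_real x * l)) * g x) \<le> exp (- (x * Re l)) * (C * exp (- b * x))"
      proof -
        have "norm (g x) \<le> C * exp (- b * x)"
          using g[of x] \<open>0 < x\<close> b(2) C
          by (meson dual_order.trans exp_le_cancel_iff less_imp_le mult_left_mono mult_right_mono neg_le_iff_le)
        then show ?thesis by (simp add: norm_mult norm_exp_eq_Re mult_left_mono)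
      qed
      also have "\<dots> = C * exp (m * x)"
        by (simp add: m_def algebra_simps flip: exp_add)
      finally show "norm (exp (- (of_real x * l)) * g x) \<le> C * exp (m * x)" .
    qed
    moreover have "C / m * exp (m * 0) \<ge> 0" using C m by simp
    moreover have "norm (h t) \<le> norm (h t - h 0) + norm (f 0)"
      using norm_triangle_sub[of "h t" "h 0"] by (simp add: h_def)
    ultimately show ?thesis by linarith
  qed
  have "norm (f t) \<le> (norm (f 0) + C / m) * exp (- b * t)" if "t \<ge> 0" for t
  proof -
    have "f t = exp (of_real t * l) * h t"
      by (simp add: h_def mult.assoc[symmetric] exp_minus_inverse)
    then have "norm (f t) = exp (t * Re l) * norm (h t)"
      by (simp add: norm_mult norm_exp_eq_Re)
    also have "\<dots> \<le> exp (t * Re l) * (norm (f 0) + C / m * exp (m * t))"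
      by (intro mult_left_mono bound that) simp
    also have "\<dots> = norm (f 0) * exp (t * Re l) + C / m * exp (- b * t)"
      by (simp add: m_def algebra_simps flip: exp_add)
    also have "\<dots> \<le> norm (f 0) * exp (- b * t) + C / m * exp (- b * t)"
      using b(3) that mult_left_mono[of "Re l" "- b" t] by (intro add_right_mono mult_left_mono) (auto simp: mult.commute)
    finally show ?thesis by (simp add: algebra_simps)
  qed
  then show ?thesis using b(1) by blast
qed

text \<open>The exponential is formed over the reals and only then complexified, so complex
  eigenvalues can be used while the derivative rule of \<open>mat_exp\<close> still applies.\<close>

definition complex_exp_action :: "real ^ 'n ^ 'n \<Rightarrow> complex ^ 'n \<Rightarrow> real \<Rightarrow> complex ^ 'n" where
  "complex_exp_action A v t = map_matrix complex_of_real (mat_exp (t *\<^sub>R A)) *v v"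

lemma complex_exp_action_has_vector_derivative:
  "((\<lambda>t. complex_exp_action A v t $ i) has_vector_derivative
     complex_exp_action A (map_matrix complex_of_real A *v v) t $ i) (at t)"
proof -
  let ?F = "\<lambda>M :: real ^ 'a ^ 'a. (map_matrix complex_of_real M *v v) $ i"
  have "linear ?F"
    by (rule linearI) (simp_all add: matrix_vector_mult_def algebra_simps sum.distrib scaleR_sum_right scaleR_conv_of_real[where 'a = complex] sum_distrib_left)
  then have "bounded_linear ?F" by (simp add: linear_conv_bounded_linear)
  then have "((\<lambda>t. ?F (mat_exp (t *\<^sub>R A))) has_vector_derivative ?F (A ** mat_exp (t *\<^sub>R A))) (at t)"
    by (rule bounded_linear.has_vector_derivative) (rule mat_exp_has_vector_derivative)
  moreover have "map_matrix complex_of_real (M ** A) = map_matrix complex_of_real M ** map_matrix complex_of_real A"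
    for M :: "real ^ 'a ^ 'a"
    by (simp add: vec_eq_iff matrix_matrix_mult_def)
  ultimately show ?thesis
    by (simp add: complex_exp_action_def matrix_vector_mul_assoc flip: mat_exp_commute)
qed

text \<open>Induction on the degree of a polynomial annihilating \<open>v\<close>. Splitting off a
  root \<open>l\<close> leaves a scalar equation for each coordinate, with a forcing term that
  decays by the induction hypothesis.\<close>

lemma complex_exp_action_decay:
  assumes "hurwitz A" and "p \<noteq> 0" "poly_act (map_matrix complex_of_real A) p v = 0"
  shows "\<exists>a>0. \<exists>C. \<forall>t\<ge>0. norm (complex_exp_action A v t $ i) \<le> C * exp (- a * t)"
  using assms(2,3)
proof (induction "degree p" arbitrary: p v)
  case 0
  then obtain c where "p = [:c:]" "c \<noteq> 0" by (metis degree_eq_zeroE pCons_0_0)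
  with 0 have "v = 0" by (simp add: poly_act_pCons)
  then show ?case by (intro exI[of _ 1] conjI exI[of _ 0]) (simp_all add: complex_exp_action_def)
next
  case (Suc d)
  let ?B = "map_matrix complex_of_real A"
  have "\<not> constant (poly p)" using Suc(2) by (simp add: constant_degree)
  then obtain l where "poly p l = 0" using fundamental_theorem_of_algebra by blast
  then obtain q where q: "p = [:- l, 1:] * q" by (auto simp: poly_eq_0_iff_dvd)
  have "q \<noteq> 0" using Suc(3) q by auto
  then have "degree p = Suc (degree q)" unfolding q by (subst degree_mult_eq) auto
  then have "degree q = d" using Suc(2) by simp
  define u where "u = poly_act ?B q v"
  show ?case
  \<comment> \<open>If \<open>u = 0\<close>, then \<open>q\<close> already annihilates
    \<open>v\<close>. Otherwise \<open>u\<close> is an eigenvector for \<open>l\<close>, and the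
    Hurwitz condition gives \<open>Re l < 0\<close>.\<close>
  proof (cases "u = 0")
    case True
    then show ?thesis
      using \<open>q \<noteq> 0\<close> \<open>degree q = d\<close> by (intro Suc(1)[of q v]) (simp_all add: u_def)
  next
    case False
    have "poly_act ?B [:- l, 1:] u = 0" using Suc(4) by (simp only: q poly_act_mult u_def)
    then have "?B *v u = l *s u" by (simp add: poly_act_pCons vec.scale_minus_left)
    with False have "eigenvalue ?B l" by (auto simp: eigenvalue_def)
    with assms(1) have l: "Re l < 0" by (simp add: hurwitz_def)
    \<comment> \<open>\<open>w\<close> is the defect of \<open>v\<close> from being an eigenvector
      for \<open>l\<close>. It is annihilated by \<open>q\<close>, whose degree is smaller by
      one.\<close>
    define w where "w = poly_act ?B [:- l, 1:] v"
    have w: "?B *v v = l *s v + w" by (simp add: w_def poly_act_pCons)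
    have "poly_act ?B q w = 0"
      using Suc(4) by (simp only: q w_def poly_act_mult[symmetric] mult.commute)
    with \<open>q \<noteq> 0\<close> \<open>degree q = d\<close>
    have "\<exists>a>0. \<exists>C. \<forall>t\<ge>0. norm (complex_exp_action A w t $ i) \<le> C * exp (- a * t)"
      by (intro Suc(1)[of q w]) simp_all
    then obtain a C where aC: "a > 0" "\<forall>t\<ge>0. norm (complex_exp_action A w t $ i) \<le> C * exp (- a * t)"
      by blast
    show ?thesis
    proof (rule exp_decay_of_linear_ode)
      show "((\<lambda>t. complex_exp_action A v t $ i) has_vector_derivative
          l * complex_exp_action A v t $ i + complex_exp_action A w t $ i) (at t)" for t
        using complex_exp_action_has_vector_derivative[of A v i t]
        by (simp add: w complex_exp_action_def vec.add vec.scale)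
    qed (use l aC in auto)
  qed
qed

text \<open>The relation is taken in the underlying real vector space, so its coefficients are real
  and are embedded into the complex numbers afterwards.\<close>

lemma exists_poly_act_eq_0:
  fixes B :: "complex ^ 'n ^ 'n"
  obtains p where "p \<noteq> 0" "poly_act B p v = 0"
proof -
  let ?N = "DIM(complex ^ 'n)"
  obtain c where c: "\<exists>i\<le>?N. c i \<noteq> 0" "(\<Sum>i\<le>?N. c i *\<^sub>R (((*v) B) ^^ i) v) = 0"
    by (rule exists_linear_relation)
  define p where "p = (\<Sum>i\<le>?N. monom (complex_of_real (c i)) i)"
  have "p \<noteq> 0"
    using c(1) coeff_sum_monom[of "{..?N}" "\<lambda>i. complex_of_real (c i)"] unfolding p_def
    by (metis atMost_iff coeff_0 finite_atMost of_real_eq_0_iff)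
  moreover have "complex_of_real r *s w = r *\<^sub>R w" for r and w :: "complex ^ 'n"
    by (simp add: vec_eq_iff scaleR_conv_of_real[where 'a = complex])
  then have "poly_act B p v = 0"
    using c(2) by (simp only: p_def poly_act_sum poly_act_monom)
  ultimately show ?thesis using that by blast
qed

lemma trajectory_tendsto_0:
  assumes "hurwitz A"
  shows "(trajectory A x \<longlongrightarrow> 0) at_top"
proof (rule vec_tendstoI)
  fix i
  define v :: "complex ^ 'a" where "v = (\<chi> j. complex_of_real (x $ j))"
  obtain p where "p \<noteq> 0" "poly_act (map_matrix complex_of_real A) p v = 0"
    by (rule exists_poly_act_eq_0)
  then obtain a C where "a > 0"
    and aC: "\<And>t. t \<ge> 0 \<Longrightarrow> norm (complex_exp_action A v t $ i) \<le> C * exp (- a * t)"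
    using complex_exp_action_decay[OF assms] by blast
  have "complex_exp_action A v t $ i = of_real (trajectory A x t $ i)" for t
    by (simp add: complex_exp_action_def trajectory_def v_def matrix_vector_mult_def)
  then have "\<bar>trajectory A x t $ i\<bar> \<le> C * exp (- a * t)" if "t \<ge> 0" for t
    using aC[OF that] by simp
  then have "\<forall>\<^sub>F t in at_top. norm (trajectory A x t $ i) \<le> C * exp (- a * t)"
    by (intro eventually_mono[OF eventually_ge_at_top[of 0]]) simp
  moreover have "((\<lambda>t. C * exp (- a * t)) \<longlongrightarrow> 0) at_top"
    using \<open>a > 0\<close> by real_asymp
  ultimately show "((\<lambda>t. trajectory A x t $ i) \<longlongrightarrow> 0 $ i) at_top"
    by (simp add: Lim_null_comparison)
qed

section \<open>Generic points, the trajectory space and the cut time\<close>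

text \<open>A finite spanning set of the smallest invariant subspace containing \<open>x\<close>.
  Its cardinality is at most the degree of the minimal polynomial.\<close>

definition krylov :: "real ^ 'n ^ 'n \<Rightarrow> real ^ 'n \<Rightarrow> (real ^ 'n) set" where
  "krylov A x = (\<lambda>i. mat_pow A i *v x) ` {..<degree (min_poly A)}"

text \<open>The coefficients are those of the remainder of the \<open>k\<close>-th monomial modulo
  \<open>min_poly A\<close>. They do not depend on \<open>x\<close>, which is what allows powers to
  be transferred between two starting points.\<close>

lemma mat_pow_mult_vec_reduced:
  obtains c where "\<And>x. mat_pow A k *v x = (\<Sum>i<degree (min_poly A). c i *\<^sub>R (mat_pow A i *v x))"
proof
  fix x
  let ?r = "monom 1 k mod min_poly A" and ?n = "degree (min_poly A)"
  have "?r = 0 \<or> degree ?r < ?n"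
    by (rule degree_mod_less) (rule min_poly_nonzero)
  \<comment> \<open>The remainder may be 0, of degree 0. Positivity of \<open>?n\<close> makes
    \<open>?n - 1\<close> a valid degree bound in that case too.\<close>
  with degree_min_poly_pos[of A] have "degree ?r \<le> ?n - 1" "{..?n - 1} = {..<?n}"
    by auto
  have "mat_pow A k *v x = poly_act A ?r x"
    by (simp add: poly_act_mod_min_poly poly_act_monom funpow_mult_vec_eq_mat_pow)
  also have "\<dots> = (\<Sum>i<?n. coeff ?r i *\<^sub>R (mat_pow A i *v x))"
    using poly_act_upper[OF \<open>degree ?r \<le> ?n - 1\<close>, of A x] \<open>{..?n - 1} = {..<?n}\<close>
    by (simp add: funpow_mult_vec_eq_mat_pow scalar_mult_eq_scaleR)
  finally show "mat_pow A k *v x = (\<Sum>i<?n. coeff ?r i *\<^sub>R (mat_pow A i *v x))" .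
qed

lemma mat_pow_in_span_krylov: "mat_pow A k *v x \<in> span (krylov A x)"
proof -
  obtain c where "mat_pow A k *v x = (\<Sum>i<degree (min_poly A). c i *\<^sub>R (mat_pow A i *v x))"
    using mat_pow_mult_vec_reduced[of A k] by metis
  then show ?thesis
    by (auto simp: krylov_def intro!: span_sum span_scale intro: span_base)
qed

lemma invariant_hull_subset_krylov: "invariant_subspace A hull {x} \<subseteq> span (krylov A x)"
proof (rule hull_minimal)
  show "{x} \<subseteq> span (krylov A x)"
    using mat_pow_in_span_krylov[of A 0 x] by simp
  have "(*v) A ` krylov A x \<subseteq> span (krylov A x)"
    using mat_pow_in_span_krylov[of A "Suc _" x] by (auto simp: krylov_def matrix_vector_mul_assoc)
  then have "span ((*v) A ` krylov A x) \<subseteq> span (krylov A x)"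
    by (simp add: span_minimal)
  then have "(*v) A ` span (krylov A x) \<subseteq> span (krylov A x)"
    by (simp add: linear_span_image)
  then show "invariant_subspace A (span (krylov A x))"
    by (auto simp: invariant_subspace_def)
qed

lemma krylov_subset_invariant_hull: "krylov A x \<subseteq> invariant_subspace A hull {x}"
proof -
  have "mat_pow A i *v x \<in> S" if "invariant_subspace A S" "x \<in> S" for i S
    using that by (induction i) (auto simp: invariant_subspace_def matrix_vector_mul_assoc[symmetric])
  then show ?thesis by (auto simp: krylov_def hull_def)
qed

lemma dim_invariant_hull: "dim (invariant_subspace A hull {x}) = dim (krylov A x)"
  using dim_subset[OF invariant_hull_subset_krylov[of A x]] dim_subset[OF krylov_subset_invariant_hull[of A x]]
  by (simp add: dim_span)

text \<open>The invariant hull has the dimension of the span of \<open>?n\<close> vectors, and that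
  dimension is \<open>?n\<close> exactly when the vectors are distinct and independent.\<close>

lemma generic_iff_independent:
  "generic A x \<longleftrightarrow>
     inj_on (\<lambda>i. mat_pow A i *v x) {..<degree (min_poly A)} \<and> independent (krylov A x)"
proof
  let ?n = "degree (min_poly A)"
  have fin: "finite (krylov A x)" and card: "card (krylov A x) \<le> ?n"
    using card_image_le[of "{..<?n}" "\<lambda>i. mat_pow A i *v x"] by (simp_all add: krylov_def)
  {
    assume "generic A x"
    then have "dim (krylov A x) = ?n" by (simp add: generic_def dim_invariant_hull)
    then have eq: "card (krylov A x) = ?n"
      using card dim_le_card'[OF fin] by simp
    then have "inj_on (\<lambda>i. mat_pow A i *v x) {..<?n}"
      by (intro eq_card_imp_inj_on) (simp_all add: krylov_def)
    moreover have "independent (krylov A x)"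
      by (rule card_le_dim_spanning[of _ "krylov A x"]) (use fin eq \<open>dim _ = ?n\<close> span_superset in auto)
    ultimately show "inj_on (\<lambda>i. mat_pow A i *v x) {..<?n} \<and> independent (krylov A x)" ..
  next
    assume "inj_on (\<lambda>i. mat_pow A i *v x) {..<?n} \<and> independent (krylov A x)"
    then show "generic A x"
      by (simp add: generic_def dim_invariant_hull dim_eq_card_independent) (simp add: krylov_def card_image)
  }
qed

text \<open>A relation among the Krylov vectors of \<open>x\<close> would be a nonzero polynomial of
  degree below \<open>?n\<close> that kills \<open>x\<close>.\<close>

lemma exists_generic: "\<exists>x. generic A x"
proof -
  let ?n = "degree (min_poly A)"
  obtain x where x: "\<And>q. q \<noteq> 0 \<Longrightarrow> degree q < ?n \<Longrightarrow> poly_act A q x \<noteq> 0"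
    using exists_min_poly_point[of A] by blast
  have "generic A x"
  proof (rule ccontr)
    assume "\<not> ?thesis"
    then obtain c where c: "\<exists>i\<in>{..<?n}. c i \<noteq> 0" "(\<Sum>i<?n. c i *\<^sub>R (mat_pow A i *v x)) = 0"
      unfolding generic_iff_independent krylov_def by (rule indexed_linear_relation[rotated]) auto
    define q where "q = (\<Sum>i<?n. monom (c i) i)"
    have "q \<noteq> 0"
      using c(1) coeff_sum_monom[of "{..<?n}" c] unfolding q_def by (metis coeff_0 finite_lessThan)
    have "degree q \<le> ?n - 1"
      unfolding q_def by (rule degree_le) (auto simp: coeff_sum_monom)
    then have "degree q < ?n" using degree_min_poly_pos[of A] by linarith
    moreover have "poly_act A q x = 0"
      using c(2) by (simp add: q_def poly_act_sum poly_act_monom funpow_mult_vec_eq_mat_pow scalar_mult_eq_scaleR)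
    ultimately show False using x[OF \<open>q \<noteq> 0\<close>] by blast
  qed
  then show ?thesis ..
qed

lemma generic_nonzero:
  assumes "generic A x"
  shows "x \<noteq> 0"
proof
  assume "x = 0"
  then have "0 \<in> krylov A x"
    using degree_min_poly_pos[of A] by (auto simp: krylov_def)
  with assms show False by (auto simp: generic_iff_independent dependent_zero)
qed

definition trajectory_functions :: "real ^ 'n ^ 'n \<Rightarrow> real ^ 'n \<Rightarrow> (real \<Rightarrow> real) set" where
  "trajectory_functions A x = range (\<lambda>y t. trajectory A x t \<bullet> y)"

text \<open>Since \<open>x\<close> is generic, \<open>A\<^sup>i x \<mapsto> A\<^sup>i z\<close> defines a linear map; it carries one trajectory to the other.\<close>

lemma trajectory_functions_subset:
  assumes "generic A x"
  shows "trajectory_functions A z \<subseteq> trajectory_functions A x"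
proof -
  let ?n = "degree (min_poly A)"
  let ?u = "\<lambda>i. mat_pow A i *v x"
  have inj: "inj_on ?u {..<?n}" and ind: "independent (krylov A x)"
    using assms by (simp_all add: generic_iff_independent)
  \<comment> \<open>The extension theorem prescribes values on vectors, not indices; injectivity
    lets \<open>the_inv_into\<close> recover the exponent of a Krylov vector.\<close>
  obtain f where f: "linear f" "\<And>v. v \<in> krylov A x \<Longrightarrow> f v = mat_pow A (the_inv_into {..<?n} ?u v) *v z"
    using linear_independent_extend[OF ind, of "\<lambda>v. mat_pow A (the_inv_into {..<?n} ?u v) *v z"] by blast
  have f_less: "f (mat_pow A i *v x) = mat_pow A i *v z" if "i < ?n" for i
    using f(2)[of "?u i"] the_inv_into_f_f[OF inj, of i] that by (simp add: krylov_def)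
  have f_pow: "f (mat_pow A k *v x) = mat_pow A k *v z" for k
  proof -
    obtain c where c: "\<And>x. mat_pow A k *v x = (\<Sum>i<?n. c i *\<^sub>R (mat_pow A i *v x))"
      using mat_pow_mult_vec_reduced[of A k] by metis
    show ?thesis
      by (simp add: c linear_sum[OF f(1)] linear_scale[OF f(1)] f_less)
  qed
  have f_traj: "f (trajectory A x t) = trajectory A z t" for t
  proof -
    have "(\<lambda>k. f ((t ^ k / fact k) *\<^sub>R (mat_pow A k *v x))) sums f (trajectory A x t)"
      using f(1) by (intro bounded_linear.sums[OF _ trajectory_sums]) (simp add: linear_conv_bounded_linear)
    then have "(\<lambda>k. (t ^ k / fact k) *\<^sub>R (mat_pow A k *v z)) sums f (trajectory A x t)"
      by (simp add: linear_scale[OF f(1)] f_pow)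
    then show ?thesis using trajectory_sums sums_unique2 by blast
  qed
  have "(\<lambda>t. trajectory A z t \<bullet> y) = (\<lambda>t. trajectory A x t \<bullet> adjoint f y)" for y
    by (simp add: adjoint_works[OF f(1)] f_traj)
  then show ?thesis by (auto simp: trajectory_functions_def)
qed

lemma trajectory_functions_generic_eq:
  assumes "generic A x" "generic A z"
  shows "trajectory_functions A x = trajectory_functions A z"
  using trajectory_functions_subset assms by blast

lemma trajectory_space_eq:
  assumes "generic A x"
  shows "trajectory_space A = trajectory_functions A x"
  unfolding trajectory_space_def trajectory_functions_def[symmetric]
proof (rule the_equality)
  show "\<forall>z. generic A z \<longrightarrow> trajectory_functions A z = trajectory_functions A x"
    using trajectory_functions_generic_eq assms by blast
qed (use assms in blast)

section \<open>Relative interior of a symmetric hull and supporting functionals\<close>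

lemma rel_interior_symmetric_hull_iff:
  fixes S :: "'a::euclidean_space set"
  assumes z: "z \<in> convex hull (S \<union> uminus ` S)"
  shows "z \<in> rel_interior (convex hull (S \<union> uminus ` S)) \<longleftrightarrow>
    (\<forall>y. (\<forall>s\<in>S. \<bar>s \<bullet> y\<bar> \<le> z \<bullet> y) \<longrightarrow> (\<forall>s\<in>S. s \<bullet> y = 0))"
    (is "z \<in> rel_interior ?G \<longleftrightarrow> ?R")
proof
  have sub: "?G \<subseteq> {w. w \<bullet> y \<le> c}" if "\<And>s. s \<in> S \<Longrightarrow> \<bar>s \<bullet> y\<bar> \<le> c" for y c
  proof (rule hull_minimal)
    show "S \<union> uminus ` S \<subseteq> {w. w \<bullet> y \<le> c}" using that by force
    show "convex {w. w \<bullet> y \<le> c}" using convex_halfspace_le[of y c] by (simp add: inner_commute)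
  qed
  have mem: "s \<in> ?G" "- s \<in> ?G" if "s \<in> S" for s
    using that by (auto intro: hull_inc)
  have cvx: "convex ?G" by (rule convex_convex_hull)
  {
    assume int: "z \<in> rel_interior ?G"
    show ?R
    proof (intro allI impI)
      fix y assume y: "\<forall>s\<in>S. \<bar>s \<bullet> y\<bar> \<le> z \<bullet> y"
      show "\<forall>s\<in>S. s \<bullet> y = 0"
      proof (cases "S = {}")
        case False
        then obtain s where "s \<in> S" by blast
        have "(1/2) *\<^sub>R s + (1/2) *\<^sub>R (- s) \<in> ?G"
          using mem[OF \<open>s \<in> S\<close>] by (intro convexD[OF cvx]) auto
        then have "0 \<in> ?G" by simp
        then have "0 \<in> affine hull ?G" by (rule hull_inc)
        \<comment> \<open>Since 0 lies in the hull, the segment from 0 to a relative interior point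
          \<open>z\<close> can be prolonged beyond \<open>z\<close>. A functional maximal at
          \<open>z\<close> with a positive value would increase there.\<close>
        then obtain e where e: "e > 1" "e *\<^sub>R z \<in> ?G"
          using convex_rel_interior_if[OF cvx int] by fastforce
        then have "e * (z \<bullet> y) \<le> z \<bullet> y" using sub[of y "z \<bullet> y"] y by fastforce
        then have "(e - 1) * (z \<bullet> y) \<le> 0" by (simp add: algebra_simps)
        with e(1) have "z \<bullet> y \<le> 0" by (simp add: mult_le_0_iff)
        with y show ?thesis by fastforce
      qed simp
    qed
  next
    assume R: ?R
    show "z \<in> rel_interior ?G"
    proof (rule ccontr)
      assume "z \<notin> rel_interior ?G"
      then obtain a where a: "\<And>w. w \<in> ?G \<Longrightarrow> a \<bullet> z \<le> a \<bullet> w" "\<And>w. w \<in> rel_interior ?G \<Longrightarrow> a \<bullet> z < a \<bullet> w"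
        using supporting_hyperplane_rel_boundary[OF cvx z] by metis
      \<comment> \<open>The maximised functional is \<open>- a\<close>, and symmetry makes its bound
        two-sided. By \<open>?R\<close> it vanishes on the whole hull, contradicting strictness at
        relative interior points.\<close>
      have "\<forall>s\<in>S. \<bar>s \<bullet> (- a)\<bar> \<le> z \<bullet> (- a)"
        using a(1)[OF mem(1)] a(1)[OF mem(2)] by (force simp: inner_commute)
      with R have "\<forall>s\<in>S. s \<bullet> (- a) = 0" by blast
      then have 0: "s \<bullet> a = 0" if "s \<in> S" for s using that by simp
      have "w \<bullet> a \<le> 0" "w \<bullet> (- a) \<le> 0" if "w \<in> ?G" for w
        using sub[of a 0] sub[of "- a" 0] 0 that by auto
      then have zero: "a \<bullet> w = 0" if "w \<in> ?G" for w using that by (force simp: inner_commute)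
      obtain w where "w \<in> rel_interior ?G" using rel_interior_eq_empty[OF cvx] z by blast
      with a(2)[OF this] zero[of w] zero[OF z] rel_interior_subset show False by auto
    qed
  }
qed

lemma sym_hull_eq: "sym_hull A x = convex hull (trajectory A x ` {0..} \<union> uminus ` trajectory A x ` {0..})"
  by (simp add: sym_hull_def image_image)

lemma trajectory_in_sym_hull: "t \<ge> 0 \<Longrightarrow> trajectory A x t \<in> sym_hull A x"
  by (auto simp: sym_hull_eq intro!: hull_inc)

lemma trajectory_in_rel_interior_iff:
  assumes "s \<ge> 0"
  shows "trajectory A x s \<in> rel_interior (sym_hull A x) \<longleftrightarrow>
    (\<forall>p\<in>trajectory_functions A x. (\<forall>t\<ge>0. \<bar>p t\<bar> \<le> p s) \<longrightarrow> (\<forall>t\<ge>0. p t = 0))"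
proof -
  let ?X = "trajectory A x"
  have "?X s \<in> rel_interior (sym_hull A x) \<longleftrightarrow>
      (\<forall>y. (\<forall>t\<in>{0..}. \<bar>?X t \<bullet> y\<bar> \<le> ?X s \<bullet> y) \<longrightarrow> (\<forall>t\<in>{0..}. ?X t \<bullet> y = 0))"
    using rel_interior_symmetric_hull_iff[of "?X s" "?X ` {0..}"] trajectory_in_sym_hull[OF assms, of A x]
    by (simp only: sym_hull_eq[symmetric] ball_simps)
  then show ?thesis by (auto simp: trajectory_functions_def)
qed

text \<open>The criterion for relative interior points involves only
  \<open>trajectory_functions\<close>, which all generic points share, so they have the same cut
  tail points.\<close>

lemma T_cut_eq:
  assumes "generic A x"
  shows "T_cut A = T_cut_at A x"
  unfolding T_cut_def
proof (rule the_equality)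
  have "cut_tail_point A z = cut_tail_point A x" if "generic A z" for z
    using trajectory_functions_generic_eq[OF assms that]
    by (intro ext) (auto simp: cut_tail_point_def trajectory_in_rel_interior_iff)
  then show "\<forall>z. generic A z \<longrightarrow> T_cut_at A z = T_cut_at A x"
    by (simp add: T_cut_at_def)
qed (use assms in blast)

section \<open>Time shifts, persistence in the relative interior and the cut time\<close>

lemma trajectory_functions_shift:
  assumes "p \<in> trajectory_functions A x"
  shows "(\<lambda>t. p (d + t)) \<in> trajectory_functions A x"
proof -
  obtain y where y: "p = (\<lambda>t. trajectory A x t \<bullet> y)"
    using assms by (auto simp: trajectory_functions_def)
  let ?E = "mat_exp (d *\<^sub>R A)"
  have "trajectory A x (d + t) \<bullet> y = trajectory A x t \<bullet> (transpose ?E *v y)" for t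
    using dot_lmul_matrix[of "trajectory A x t" "transpose ?E" y]
    by (simp add: trajectory_add)
  then show ?thesis unfolding y trajectory_functions_def by auto
qed

lemma trajectory_stays_in_rel_interior:
  assumes "trajectory A x s \<in> rel_interior (sym_hull A x)" "0 \<le> s" "s \<le> s'"
  shows "trajectory A x s' \<in> rel_interior (sym_hull A x)"
proof -
  have "\<forall>t\<ge>0. p t = 0" if p: "p \<in> trajectory_functions A x" "\<forall>t\<ge>0. \<bar>p t\<bar> \<le> p s'" for p
  proof -
    \<comment> \<open>The shift moves a peak at \<open>s'\<close> to a peak at \<open>s\<close>,
      where the criterion is available.\<close>
    let ?q = "\<lambda>t. p (s' - s + t)"
    have "\<forall>t\<ge>0. \<bar>?q t\<bar> \<le> ?q s" using p(2) assms(3) by simp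
    then have "\<forall>t\<ge>0. ?q t = 0"
      by (rule bspec[OF iffD1[OF trajectory_in_rel_interior_iff[OF assms(2)] assms(1)]
            trajectory_functions_shift[OF p(1)], THEN mp])
    then have "p s' = 0" using assms(2) by force
    with p(2) show ?thesis by simp
  qed
  then show ?thesis using assms(2,3) by (simp add: trajectory_in_rel_interior_iff)
qed

lemma cut_tail_point_iff:
  "cut_tail_point A x T \<longleftrightarrow> T > 0 \<and> trajectory A x T \<in> rel_interior (sym_hull A x)"
  unfolding cut_tail_point_def using trajectory_stays_in_rel_interior[of A x T] by auto

text \<open>The relative interior is open in the affine hull, which contains the trajectory for
  \<open>t \<ge> 0\<close>. The filter is left general to cover both \<open>at_top\<close> and
  \<open>at_left T\<close>.\<close>

lemma eventually_trajectory_in_rel_interior: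
  assumes "(trajectory A x \<longlongrightarrow> l) F" "l \<in> rel_interior (sym_hull A x)" "\<forall>\<^sub>F t in F. t \<ge> 0"
  shows "\<forall>\<^sub>F t in F. trajectory A x t \<in> rel_interior (sym_hull A x)"
proof -
  obtain U where U: "open U" "rel_interior (sym_hull A x) = affine hull sym_hull A x \<inter> U"
    using openin_rel_interior[of "sym_hull A x"] by (auto simp: openin_open)
  then have "\<forall>\<^sub>F t in F. trajectory A x t \<in> U"
    using assms(1,2) by (intro topological_tendstoD) auto
  with assms(3) show ?thesis
    by eventually_elim (simp add: U(2) hull_inc[OF trajectory_in_sym_hull])
qed

lemma T_cut_at_less_iff:
  assumes "hurwitz A" "T > 0"
  shows "T_cut_at A x < T \<longleftrightarrow> trajectory A x T \<in> rel_interior (sym_hull A x)"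
proof -
  let ?G = "sym_hull A x"
  have "x \<in> trajectory A x ` {0..}" by (rule image_eqI[of _ _ 0]) simp_all
  then have "(1/2) *\<^sub>R x + (1/2) *\<^sub>R (- x) \<in> ?G"
    unfolding sym_hull_eq by (intro convexD[OF convex_convex_hull] hull_inc) auto
  \<comment> \<open>At \<open>z = 0\<close> the criterion is trivial: a functional bounded by 0 in
    absolute value vanishes.\<close>
  then have "0 \<in> rel_interior ?G"
    using rel_interior_symmetric_hull_iff[of 0 "trajectory A x ` {0..}"]
    by (simp add: sym_hull_eq)
  then have "\<forall>\<^sub>F t in at_top. trajectory A x t \<in> rel_interior ?G"
    by (intro eventually_trajectory_in_rel_interior[OF trajectory_tendsto_0[OF assms(1)]] eventually_ge_at_top)
  then have "\<forall>\<^sub>F t in at_top. cut_tail_point A x t"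
    using eventually_gt_at_top[of 0] by eventually_elim (simp add: cut_tail_point_iff)
  then have ne: "{T. cut_tail_point A x T} \<noteq> {}"
    by (auto simp: eventually_at_top_linorder)
  have bdd: "bdd_below {T. cut_tail_point A x T}"
    by (rule bdd_belowI[of _ 0]) (auto simp: cut_tail_point_iff)
  have "T_cut_at A x < T \<longleftrightarrow> (\<exists>s<T. cut_tail_point A x s)"
    unfolding T_cut_at_def using cInf_less_iff[OF ne bdd] by auto
  also have "\<dots> \<longleftrightarrow> trajectory A x T \<in> rel_interior ?G"
  proof
    assume "\<exists>s<T. cut_tail_point A x s"
    then show "trajectory A x T \<in> rel_interior ?G" by (auto simp: cut_tail_point_def)
  next
    \<comment> \<open>Moving slightly to the left of \<open>T\<close> stays inside, which makes the
      inequality for the infimum strict.\<close>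
    assume int: "trajectory A x T \<in> rel_interior ?G"
    have "(trajectory A x \<longlongrightarrow> trajectory A x T) (at_left T)"
      using continuous_on_trajectory[of UNIV A x] by (simp add: continuous_on_def filterlim_at_split)
    moreover have pos: "\<forall>\<^sub>F t in at_left T. t > 0"
      using eventually_at_left_real[OF assms(2)] by eventually_elim simp
    then have "\<forall>\<^sub>F t in at_left T. t \<ge> 0" by eventually_elim simp
    ultimately have "\<forall>\<^sub>F t in at_left T. trajectory A x t \<in> rel_interior ?G"
      using int by (intro eventually_trajectory_in_rel_interior)
    then have "\<forall>\<^sub>F t in at_left T. t < T \<and> cut_tail_point A x t"
      using pos eventually_at_left_real[OF assms(2)]
      by eventually_elim (auto simp: cut_tail_point_iff)
    then show "\<exists>s<T. cut_tail_point A x s"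
      using eventually_happens'[OF trivial_limit_at_left_real[of T]] by blast
  qed
  finally show ?thesis .
qed

section \<open>The extremal problem\<close>

lemma bdd_above_unif_norm:
  fixes p :: "real \<Rightarrow> real"
  assumes "continuous_on {0..T} p"
  shows "bdd_above ((\<lambda>t. \<bar>p t\<bar>) ` {0..T})"
proof -
  have "compact ((\<lambda>t. \<bar>p t\<bar>) ` {0..T})"
    by (intro compact_continuous_image continuous_on_rabs assms compact_Icc)
  then show ?thesis by (intro bounded_imp_bdd_above compact_imp_bounded)
qed

lemma abs_le_unif_norm:
  assumes "continuous_on {0..T} p" "t \<in> {0..T}"
  shows "\<bar>p t\<bar> \<le> unif_norm T p"
  unfolding unif_norm_def using assms by (intro cSUP_upper bdd_above_unif_norm)

lemma unif_norm_least:
  assumes "T \<ge> 0" "\<And>t. t \<in> {0..T} \<Longrightarrow> \<bar>p t\<bar> \<le> c"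
  shows "unif_norm T p \<le> c"
  unfolding unif_norm_def using assms by (intro cSUP_least) auto

lemma unif_norm_scale:
  assumes "T \<ge> 0" "continuous_on {0..T} p"
  shows "unif_norm T (\<lambda>t. c * p t) = \<bar>c\<bar> * unif_norm T p"
proof (rule antisym)
  show "unif_norm T (\<lambda>t. c * p t) \<le> \<bar>c\<bar> * unif_norm T p"
    using assms by (intro unif_norm_least) (auto simp: abs_mult intro!: mult_left_mono abs_le_unif_norm)
  have "unif_norm T p \<ge> 0"
    using abs_le_unif_norm[OF assms(2), of 0] assms(1) by force
  show "\<bar>c\<bar> * unif_norm T p \<le> unif_norm T (\<lambda>t. c * p t)"
  proof (cases "c = 0")
    case True
    then show ?thesis using abs_le_unif_norm[of T "\<lambda>t. c * p t" 0] assms(1) by simp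
  next
    case False
    have "\<bar>p t\<bar> \<le> unif_norm T (\<lambda>t. c * p t) / \<bar>c\<bar>" if "t \<in> {0..T}" for t
      using abs_le_unif_norm[of T "\<lambda>t. c * p t" t] that assms(2) False
      by (simp add: field_simps abs_mult continuous_intros)
    then have "unif_norm T p \<le> unif_norm T (\<lambda>t. c * p t) / \<bar>c\<bar>"
      by (intro unif_norm_least assms)
    then show ?thesis using False by (simp add: field_simps)
  qed
qed

text \<open>Minimising the norm under \<open>X T \<bullet> y = 1\<close> amounts to maximising the
  ratio of \<open>X T \<bullet> y\<close> to the norm, which is attained on a compact
  sphere.\<close>

lemma exists_min_unif_norm:
  fixes X :: "real \<Rightarrow> 'a::euclidean_space"
  assumes cont: "continuous_on {0..T} X" and "T \<ge> 0" and "X T \<noteq> 0"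
  obtains y where "X T \<bullet> y = 1"
    and "\<And>z. X T \<bullet> z = 1 \<Longrightarrow> unif_norm T (\<lambda>t. X t \<bullet> y) \<le> unif_norm T (\<lambda>t. X t \<bullet> z)"
proof -
  define f where "f y = unif_norm T (\<lambda>t. X t \<bullet> y)" for y
  \<comment> \<open>The seminorm \<open>f\<close> vanishes on the orthogonal complement of
    \<open>V\<close>; restricted to \<open>V\<close> it is positive away from 0.\<close>
  define V where "V = span (X ` {0..T})"
  define C where "C = sphere 0 1 \<inter> V"
  have cont_inner: "continuous_on {0..T} (\<lambda>t. X t \<bullet> y)" for y
    by (intro continuous_intros cont)
  have f_ge: "\<bar>X t \<bullet> y\<bar> \<le> f y" if "t \<in> {0..T}" for t y
    unfolding f_def by (rule abs_le_unif_norm[OF cont_inner that])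
  have f_scale: "f (c *\<^sub>R y) = \<bar>c\<bar> * f y" for c y
    using unif_norm_scale[OF \<open>T \<ge> 0\<close> cont_inner, of c y] by (simp add: f_def)
  have in_V: "X t \<in> V" if "t \<in> {0..T}" for t using that by (simp add: V_def span_base)
  have "T \<in> {0..T}" using \<open>T \<ge> 0\<close> by simp
  have "bounded (X ` {0..T})"
    by (intro compact_imp_bounded compact_continuous_image cont) simp
  then obtain K where K: "\<And>t. t \<in> {0..T} \<Longrightarrow> norm (X t) \<le> K"
    unfolding bounded_iff by blast
  have "K \<ge> 0" using K[OF \<open>T \<in> {0..T}\<close>] norm_ge_zero[of "X T"] by linarith
  have lip: "f y \<le> f z + K * norm (y - z)" for y z
    unfolding f_def[of y]
  proof (rule unif_norm_least[OF \<open>T \<ge> 0\<close>])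
    fix t assume t: "t \<in> {0..T}"
    have "\<bar>X t \<bullet> y\<bar> \<le> \<bar>X t \<bullet> z\<bar> + \<bar>X t \<bullet> (y - z)\<bar>" by (simp add: inner_diff_right)
    also have "\<bar>X t \<bullet> (y - z)\<bar> \<le> norm (X t) * norm (y - z)" by (rule Cauchy_Schwarz_ineq2)
    also have "\<dots> \<le> K * norm (y - z)" by (intro mult_right_mono K t) simp
    finally show "\<bar>X t \<bullet> y\<bar> \<le> f z + K * norm (y - z)" using f_ge[OF t, of z] by simp
  qed
  have "K-lipschitz_on UNIV f"
  proof (rule lipschitz_onI[OF _ \<open>K \<ge> 0\<close>])
    show "dist (f y) (f z) \<le> K * dist y z" for y z
      using lip[of y z] lip[of z y] by (simp add: dist_norm norm_minus_commute abs_le_iff)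
  qed
  then have "continuous_on UNIV f" by (rule lipschitz_on_continuous_on)
  then have cont_f: "continuous_on C f" by (rule continuous_on_subset) simp
  have f_pos: "f y > 0" if "y \<in> V" "y \<noteq> 0" for y
  proof (rule ccontr)
    assume "\<not> f y > 0"
    then have orth: "orthogonal y (X t)" if "t \<in> {0..T}" for t
      using f_ge[OF that, of y] by (simp add: orthogonal_def inner_commute)
    have "orthogonal y y"
      by (rule orthogonal_to_span[OF that(1)[unfolded V_def]]) (elim imageE, simp only: orth)
    with \<open>y \<noteq> 0\<close> show False by (simp add: orthogonal_self)
  qed
  have norm_C: "y /\<^sub>R norm y \<in> C" if "y \<in> V" "y \<noteq> 0" for y
    using that by (simp add: C_def V_def span_scale)
  have C_props: "y \<in> V" "y \<noteq> 0" if "y \<in> C" for y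
    using that by (auto simp: C_def)
  \<comment> \<open>Maximising this scale-invariant ratio on a compact sphere avoids a coercivity estimate for \<open>f\<close>.\<close>
  define g where "g y = (X T \<bullet> y) / f y" for y
  have g_scale: "g (c *\<^sub>R y) = g y" if "c > 0" for c y
    using that by (simp add: g_def f_scale)
  have "compact C" unfolding C_def V_def by (intro compact_Int_closed closed_span compact_sphere)
  moreover have "C \<noteq> {}" using norm_C[OF in_V[OF \<open>T \<in> {0..T}\<close>] \<open>X T \<noteq> 0\<close>] by blast
  moreover have "continuous_on C g"
    unfolding g_def using f_pos C_props by (intro continuous_intros cont_f) force
  ultimately obtain y0 where y0: "y0 \<in> C" "\<And>y. y \<in> C \<Longrightarrow> g y \<le> g y0"
    using continuous_attains_sup by metis
  have g_le: "g y \<le> g y0" if "y \<in> V" "y \<noteq> 0" for y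
    using y0(2)[OF norm_C[OF that]] g_scale[of "inverse (norm y)" y] that by simp
  have "f y0 > 0" using f_pos C_props y0(1) by blast
  \<comment> \<open>Testing the ratio at \<open>X T\<close> itself, where the numerator is a squared
    norm, shows that the maximum is positive and can be normalised.\<close>
  have "g (X T) > 0"
    unfolding g_def using f_pos[OF in_V[OF \<open>T \<in> {0..T}\<close>]] \<open>X T \<noteq> 0\<close> by simp
  then have "g y0 > 0"
    using g_le[OF in_V[OF \<open>T \<in> {0..T}\<close>] \<open>X T \<noteq> 0\<close>] by linarith
  then have pos: "X T \<bullet> y0 > 0" using \<open>f y0 > 0\<close> by (simp add: g_def zero_less_divide_iff)
  define y where "y = y0 /\<^sub>R (X T \<bullet> y0)"
  show ?thesis
  proof (rule that[of y])
    show "X T \<bullet> y = 1" using pos by (simp add: y_def)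
    fix z assume z: "X T \<bullet> z = 1"
    \<comment> \<open>Projecting \<open>z\<close> to \<open>V\<close> does not change the function
      on \<open>[0, T]\<close>, so the maximality of \<open>y0\<close> applies to the projection
      \<open>v\<close>.\<close>
    obtain v w where v: "v \<in> V" and w: "\<And>u. u \<in> V \<Longrightarrow> orthogonal w u" and "z = v + w"
      using orthogonal_subspace_decomp_exists[of "X ` {0..T}" z] unfolding V_def by blast
    then have eq: "X t \<bullet> z = X t \<bullet> v" if "t \<in> {0..T}" for t
      using w[OF in_V[OF that]] by (simp add: orthogonal_def inner_commute inner_add_right)
    then have "X T \<bullet> v = 1" using z \<open>T \<in> {0..T}\<close> by simp
    then have "v \<noteq> 0" by auto
    have "1 / f v \<le> g y0"
      using g_le[OF v \<open>v \<noteq> 0\<close>] \<open>X T \<bullet> v = 1\<close> by (simp add: g_def)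
    then have "f y0 / (X T \<bullet> y0) \<le> f v"
      using f_pos[OF v \<open>v \<noteq> 0\<close>] \<open>f y0 > 0\<close> pos by (simp add: g_def field_simps)
    moreover have "f y = f y0 / (X T \<bullet> y0)"
      using pos by (simp add: y_def f_scale divide_inverse mult.commute)
    moreover have "f v \<le> f z"
      unfolding f_def[of v] using f_ge[of _ z] eq by (intro unif_norm_least \<open>T \<ge> 0\<close>) auto
    ultimately show "unif_norm T (\<lambda>t. X t \<bullet> y) \<le> unif_norm T (\<lambda>t. X t \<bullet> z)"
      by (simp add: f_def)
  qed
qed

lemma trajectory_function_properties:
  assumes "p \<in> trajectory_functions A x"
  shows continuous_on_trajectory_function: "continuous_on S p"
    and trajectory_function_scale: "(\<lambda>t. c * p t) \<in> trajectory_functions A x"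
    and trajectory_function_tendsto_0: "hurwitz A \<Longrightarrow> (p \<longlongrightarrow> 0) at_top"
proof -
  obtain y where y: "p = (\<lambda>t. trajectory A x t \<bullet> y)"
    using assms by (auto simp: trajectory_functions_def)
  show "continuous_on S p" unfolding y by (intro continuous_intros continuous_on_trajectory)
  have "(\<lambda>t. c * p t) = (\<lambda>t. trajectory A x t \<bullet> (c *\<^sub>R y))" by (simp add: y)
  then show "(\<lambda>t. c * p t) \<in> trajectory_functions A x"
    unfolding trajectory_functions_def by (rule image_eqI) simp
  show "(p \<longlongrightarrow> 0) at_top" if "hurwitz A"
    using tendsto_inner[OF trajectory_tendsto_0[OF that] tendsto_const, of x y] by (simp add: y)
qed

lemma rel_interior_iff_unif_norm:
  assumes "hurwitz A" "T > 0"
  shows "trajectory A x T \<in> rel_interior (sym_hull A x) \<longleftrightarrow>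
    (\<forall>p\<in>trajectory_functions A x. p T = 1 \<longrightarrow> unif_norm T p > 1)"
proof
  assume int: "trajectory A x T \<in> rel_interior (sym_hull A x)"
  \<comment> \<open>Multiplying by the sign of \<open>p s\<close> turns a peak of the absolute value
    into the form used by the criterion. Persistence extends it from \<open>T\<close> to every later
    \<open>s\<close>.\<close>
  have no_peak: "\<not> (\<forall>t\<ge>0. \<bar>p t\<bar> \<le> \<bar>p s\<bar>)"
    if p: "p \<in> trajectory_functions A x" and "s \<ge> T" "p s \<noteq> 0" for p s
  proof
    assume peak: "\<forall>t\<ge>0. \<bar>p t\<bar> \<le> \<bar>p s\<bar>"
    let ?q = "\<lambda>t. sgn (p s) * p t"
    have q: "?q \<in> trajectory_functions A x" by (rule trajectory_function_scale[OF p])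
    have q_le: "\<forall>t\<ge>0. \<bar>?q t\<bar> \<le> ?q s"
    proof -
      have "\<bar>?q t\<bar> = \<bar>p t\<bar>" for t using \<open>p s \<noteq> 0\<close> by (simp add: abs_mult abs_sgn_eq)
      moreover have "?q s = \<bar>p s\<bar>" by (simp add: abs_sgn[of "p s"])
      ultimately show ?thesis using peak by simp
    qed
    have "s \<ge> 0" using assms(2) \<open>s \<ge> T\<close> by simp
    have "trajectory A x s \<in> rel_interior (sym_hull A x)"
      by (rule trajectory_stays_in_rel_interior[OF int]) (use assms(2) \<open>s \<ge> T\<close> in simp_all)
    then have "\<forall>t\<ge>0. ?q t = 0"
      by (rule bspec[OF iffD1[OF trajectory_in_rel_interior_iff[OF \<open>s \<ge> 0\<close>]] q, THEN mp, OF _ q_le])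
    then have "?q s = 0" using \<open>s \<ge> 0\<close> by simp
    with \<open>p s \<noteq> 0\<close> show False by (simp add: sgn_zero_iff)
  qed
  show "\<forall>p\<in>trajectory_functions A x. p T = 1 \<longrightarrow> unif_norm T p > 1"
  proof (intro ballI impI, rule ccontr)
    fix p assume p: "p \<in> trajectory_functions A x" and "p T = 1" and "\<not> unif_norm T p > 1"
    then have le1: "\<bar>p t\<bar> \<le> 1" if "t \<in> {0..T}" for t
      using abs_le_unif_norm[OF continuous_on_trajectory_function[OF p] that] by simp
    \<comment> \<open>If the absolute value never exceeded 1, then \<open>T\<close> itself would be
      a peak.\<close>
    obtain t1 where t1: "t1 \<ge> 0" "\<bar>p t1\<bar> > 1"
      using no_peak[OF p order_refl] \<open>p T = 1\<close> by (auto simp: not_le)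
    have "\<forall>\<^sub>F t in at_top. \<bar>p t\<bar> < 1"
      using trajectory_function_tendsto_0[OF p assms(1)] by (auto simp: tendsto_iff dest: spec[of _ 1])
    then obtain N where N: "\<And>t. t \<ge> N \<Longrightarrow> \<bar>p t\<bar> < 1"
      by (auto simp: eventually_at_top_linorder)
    have "t1 \<le> N" using N[of t1] t1(2) by linarith
    \<comment> \<open>Beyond \<open>N\<close> the values are below 1, so a maximum over
      \<open>[0, N]\<close>, being larger than 1, is a maximum over the whole half-line.\<close>
    obtain s where s: "s \<in> {0..N}" "\<And>t. t \<in> {0..N} \<Longrightarrow> \<bar>p t\<bar> \<le> \<bar>p s\<bar>"
      using continuous_attains_sup[of "{0..N}" "\<lambda>t. \<bar>p t\<bar>"] t1 \<open>t1 \<le> N\<close>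
        continuous_on_rabs[OF continuous_on_trajectory_function[OF p]] by fastforce
    have gt1: "\<bar>p s\<bar> > 1" using s(2)[of t1] t1 \<open>t1 \<le> N\<close> by simp
    have "\<bar>p t\<bar> \<le> \<bar>p s\<bar>" if "t \<ge> 0" for t
      using s(2)[of t] N[of t] gt1 that by (cases "t \<le> N") auto
    moreover have "s \<ge> T" using le1[of s] gt1 s(1) by force
    moreover have "p s \<noteq> 0" using gt1 by auto
    ultimately show False using no_peak[OF p] by blast
  qed
next
  assume R: "\<forall>p\<in>trajectory_functions A x. p T = 1 \<longrightarrow> unif_norm T p > 1"
  have "p t = 0" if p: "p \<in> trajectory_functions A x" "\<forall>t\<ge>0. \<bar>p t\<bar> \<le> p T" and "t \<ge> 0" for p t
  proof (rule ccontr)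
    assume "p t \<noteq> 0"
    then have "p T > 0" using p(2) \<open>t \<ge> 0\<close> by force
    \<comment> \<open>A nonzero supporting function is positive at \<open>T\<close>; dividing by
      \<open>p T\<close> gives value 1 there and norm at most 1, against \<open>R\<close>.\<close>
    let ?q = "\<lambda>t. inverse (p T) * p t"
    have "unif_norm T ?q > 1"
      using R trajectory_function_scale[OF p(1)] \<open>p T > 0\<close> by auto
    moreover have "unif_norm T ?q \<le> 1"
      using p(2) \<open>p T > 0\<close> assms(2) by (intro unif_norm_least) (auto simp: abs_mult field_simps)
    ultimately show False by simp
  qed
  then show "trajectory A x T \<in> rel_interior (sym_hull A x)"
    using assms(2) by (simp add: trajectory_in_rel_interior_iff)
qed

text \<open>\<open>extremal_min\<close> is a \<open>LEAST\<close> over the reals and means a minimum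
  only when one is attained, so attainment is asserted alongside the equivalence.\<close>

theorem theorem3:
  fixes A :: "real ^ 'n ^ 'n" and T :: real
  assumes "hurwitz A" and "T > 0"
  shows "(\<exists>p. is_arg_min (unif_norm T) (feasible A T) p) \<and>
         (T > T_cut A \<longleftrightarrow> extremal_min A T > 1)"
proof -
  obtain x where x: "generic A x" using exists_generic by blast
  have feas: "feasible A T p \<longleftrightarrow> p \<in> trajectory_functions A x \<and> p T = 1" for p
    by (simp add: feasible_def trajectory_space_eq[OF x])
  obtain y where y: "trajectory A x T \<bullet> y = 1"
    "\<And>z. trajectory A x T \<bullet> z = 1 \<Longrightarrow>
      unif_norm T (\<lambda>t. trajectory A x t \<bullet> y) \<le> unif_norm T (\<lambda>t. trajectory A x t \<bullet> z)"
    using exists_min_unif_norm[OF continuous_on_trajectory _ trajectory_nonzero[OF generic_nonzero[OF x]], of T] assms(2)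
    by (metis less_imp_le)
  define p where "p = (\<lambda>t. trajectory A x t \<bullet> y)"
  have p: "feasible A T p" using y(1) by (auto simp: feas p_def trajectory_functions_def)
  have min: "unif_norm T p \<le> unif_norm T q" if "feasible A T q" for q
    using that y(2) by (auto simp: feas p_def trajectory_functions_def)
  have "extremal_min A T = unif_norm T p"
    unfolding extremal_min_def using p min by (intro Least_equality) auto
  moreover have "T_cut A < T \<longleftrightarrow> (\<forall>q. feasible A T q \<longrightarrow> unif_norm T q > 1)"
    by (simp add: T_cut_eq[OF x] T_cut_at_less_iff[OF assms] rel_interior_iff_unif_norm[OF assms] feas) blast
  \<comment> \<open>Attainment by \<open>p\<close> is what transfers the strict inequality between
    all feasible functions and the minimum.\<close>
  moreover have "(\<forall>q. feasible A T q \<longrightarrow> unif_norm T q > 1) \<longleftrightarrow> unif_norm T p > 1"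
    using p min by force
  moreover have "is_arg_min (unif_norm T) (feasible A T) p"
    using p min by (auto simp: is_arg_min_linorder)
  ultimately show ?thesis by auto
qed

end
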